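(* Let $(X,\mathcal{L})$ be an LCS-complete topological space, and let $\mu$ and $\nu$ be two $\sigma$-finite continuous valuations on $(X,\mathcal{L})$. Let $\widetilde\mu$ and $\widetilde\nu$ be their unique extensions to Borel measures on $(X,\mathcal{B}(\mathcal{L}))$. Then the following are equivalent: (1) $\widetilde\nu$ is absolutely continuous with respect to $\widetilde\mu$; (2) there is a measurable map $g\colon (X,\mathcal{B}(\mathcal{L}))\to\overline{\mathbb{R}}_+$ such that $\nu=g\cdot\mu$. Additionally, $g$ is unique up to $\widetilde\mu$-null sets.
   Context: $\overline{\mathbb{R}}_+=[0,\infty]$. A topological space is LCS-complete if it is homeomorphic to a $G_\delta$ subset (countable intersection of open sets), with the subspace topology, of a locally compact sober space (locally compact: every point has a neighborhood base of compact sets; no Hausdorff assumption). $\mathcal{L}$ denotes the topology (family of open sets) and $\mathcal{B}(\mathcal{L})$ its Borel $\sigma$-algebra. A valuation on $(X,\mathcal{L})$ is a map $\nu\colon\mathcal{L}\to\overline{\mathbb{R}}_+$ with $\nu(\emptyset)=0$, $U\subseteq V\Rightarrow\nu(U)\le\nu(V)$, and $\nu(U)+\nu(V)=\nu(U\cup V)+\nu(U\cap V)$. It is continuous if $\nu(\bigcup_i U_i)=\sup_i\nu(U_i)$ for every directed family $(U_i)_i$ of open sets. It is $\sigma$-finite if there are countably many open sets $E_n$ with $\bigcup_n E_n=X$ and $\nu(E_n)<\infty$ for each $n$. It is a known fact that every $\sigma$-finite continuous valuation $\mu$ on an LCS-complete space extends to a unique measure $\widetilde\mu$ on $(X,\mathcal{B}(\mathcal{L}))$.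 For a measurable $g\colon(X,\mathcal{B}(\mathcal{L}))\to\overline{\mathbb{R}}_+$, $g\cdot\widetilde\mu$ is the measure $B\mapsto\int\chi_B\,g\,d\widetilde\mu$, and $g\cdot\mu$ denotes its restriction to $\mathcal{L}$, i.e. $(g\cdot\mu)(U)=\int\chi_U\,g\,d\widetilde\mu$ for $U$ open. A measure $\beta$ on a measurable space $(X,\Sigma)$ is absolutely continuous with respect to a measure $\alpha$ if for every $B_0\in\Sigma$ with $\beta(B_0)<\infty$ and every real $\epsilon>0$ there is a real $\eta>0$ such that every $B\in\Sigma$ with $B\subseteq B_0$ and $\alpha(B)<\eta$ satisfies $\beta(B)<\epsilon$. *)

theory Defs
  imports "HOL-Analysis.Analysis"
begin

definition irreducible_closedin :: "'a topology \<Rightarrow> 'a set \<Rightarrow> bool" where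
  "irreducible_closedin X C \<longleftrightarrow>
     closedin X C \<and> C \<noteq> {} \<and>
     (\<forall>A B. closedin X A \<longrightarrow> closedin X B \<longrightarrow> C \<subseteq> A \<union> B \<longrightarrow> C \<subseteq> A \<or> C \<subseteq> B)"

definition sober_space :: "'a topology \<Rightarrow> bool" where
  "sober_space X \<longleftrightarrow>
     (\<forall>C. irreducible_closedin X C \<longrightarrow> (\<exists>!x. x \<in> topspace X \<and> C = X closure_of {x}))"

text \<open>
  Without a separation axiom, \<^const>\<open>locally_compact_space\<close> (every point has some compact
  neighbourhood) is weaker than having a neighbourhood base of compact sets, hence
  \<^const>\<open>neighbourhood_base_of\<close>. The \<^typ>\<open>'b itself\<close> argument is the type of points of
  the ambient space: HOL cannot quantify existentially over types, but a hypothesis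
  \<open>LCS_complete TYPE('b) X\<close> with \<open>'b\<close> a free type variable covers ambient spaces over any type.
\<close>
definition LCS_complete :: "'b itself \<Rightarrow> 'a topology \<Rightarrow> bool" where
  "LCS_complete (_ :: 'b itself) X \<longleftrightarrow>
     (\<exists>(Y :: 'b topology) S.
        neighbourhood_base_of (compactin Y) Y \<and> sober_space Y \<and>
        gdelta_in Y S \<and> X homeomorphic_space subtopology Y S)"

text \<open>Valuations are only constrained on open sets; their values elsewhere are irrelevant.\<close>
definition valuation :: "'a topology \<Rightarrow> ('a set \<Rightarrow> ennreal) \<Rightarrow> bool" where
  "valuation X \<nu> \<longleftrightarrow>
     \<nu> {} = 0 \<and>
     (\<forall>U V. openin X U \<longrightarrow> openin X V \<longrightarrow> U \<subseteq> V \<longrightarrow> \<nu> U \<le> \<nu> V) \<and>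
     (\<forall>U V. openin X U \<longrightarrow> openin X V \<longrightarrow> \<nu> U + \<nu> V = \<nu> (U \<union> V) + \<nu> (U \<inter> V))"

definition directed_family :: "'a set set \<Rightarrow> bool" where
  "directed_family D \<longleftrightarrow> D \<noteq> {} \<and> (\<forall>U\<in>D. \<forall>V\<in>D. \<exists>W\<in>D. U \<subseteq> W \<and> V \<subseteq> W)"

definition continuous_valuation :: "'a topology \<Rightarrow> ('a set \<Rightarrow> ennreal) \<Rightarrow> bool" where
  "continuous_valuation X \<nu> \<longleftrightarrow>
     valuation X \<nu> \<and>
     (\<forall>D. (\<forall>U\<in>D. openin X U) \<longrightarrow> directed_family D \<longrightarrow> \<nu> (\<Union>D) = (SUP U\<in>D. \<nu> U))"

definition sigma_finite_valuation :: "'a topology \<Rightarrow> ('a set \<Rightarrow> ennreal) \<Rightarrow> bool" where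
  "sigma_finite_valuation X \<nu> \<longleftrightarrow>
     (\<exists>E :: nat \<Rightarrow> 'a set. (\<forall>n. openin X (E n) \<and> \<nu> (E n) < \<infinity>) \<and> (\<Union>n. E n) = topspace X)"

definition borel_extension :: "'a topology \<Rightarrow> ('a set \<Rightarrow> ennreal) \<Rightarrow> 'a measure \<Rightarrow> bool" where
  "borel_extension X \<nu> M \<longleftrightarrow>
     space M = topspace X \<and>
     sets M = sigma_sets (topspace X) {U. openin X U} \<and>
     (\<forall>U. openin X U \<longrightarrow> emeasure M U = \<nu> U)"

text \<open>
  Not the library's \<^const>\<open>absolutely_continuous\<close>, which is inclusion of null sets. The
  arguments are in the same order: \<open>\<beta>\<close> is absolutely continuous with respect to \<open>\<alpha>\<close>.
\<close>
definition eps_absolutely_continuous :: "'a measure \<Rightarrow> 'a measure \<Rightarrow> bool" where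
  "eps_absolutely_continuous \<alpha> \<beta> \<longleftrightarrow>
     (\<forall>B0\<in>sets \<beta>. emeasure \<beta> B0 < \<infinity> \<longrightarrow>
        (\<forall>\<epsilon>::real. \<epsilon> > 0 \<longrightarrow>
           (\<exists>\<eta>::real. \<eta> > 0 \<and>
              (\<forall>B\<in>sets \<beta>. B \<subseteq> B0 \<longrightarrow> emeasure \<alpha> B < ennreal \<eta> \<longrightarrow> emeasure \<beta> B < ennreal \<epsilon>))))"

text \<open>\<open>\<nu> = g \<cdot> \<mu>\<close>, where \<open>M\<close> is the Borel measure extending \<open>\<mu>\<close>.\<close>
definition is_density_valuation ::
  "'a topology \<Rightarrow> 'a measure \<Rightarrow> ('a \<Rightarrow> ennreal) \<Rightarrow> ('a set \<Rightarrow> ennreal) \<Rightarrow> bool" where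
  "is_density_valuation X M g \<nu> \<longleftrightarrow>
     (\<forall>U. openin X U \<longrightarrow> \<nu> U = (\<integral>\<^sup>+x\<in>U. g x \<partial>M))"

end

theory Submission
  imports Defs
begin

text \<open>
  For a \<open>\<sigma>\<close>-finite measure, the \<open>\<epsilon>\<close>-\<open>\<eta>\<close> notion of absolute continuity coincides with inclusion of
  null sets: if some \<open>\<epsilon>\<close> admits no \<open>\<eta>\<close>, choose counterexamples of summable mass; by the
  Borel--Cantelli lemma their limes superior is null for the one measure but not for the other.
  Open sets form an intersection-stable generator of the Borel sets, so a density that represents
  \<open>\<nu>\<close> on open sets represents its Borel extension, and the Radon--Nikodym theorem applies.
\<close>

text \<open>A set of \<open>M\<close>-measure zero lies below every threshold \<eta>, so its
  \<open>N\<close>-measure is below every \<epsilon>. The definition says this only inside sets of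
  finite \<open>N\<close>-measure, hence \<sigma>-finiteness of \<open>N\<close> is used to cut
  \<open>B\<close> into countably many such pieces.\<close>

lemma absolutely_continuous_if_eps_absolutely_continuous:
  assumes eac: "eps_absolutely_continuous M N" and sets_eq: "sets N = sets M"
    and "sigma_finite_measure N"
  shows "absolutely_continuous M N"
  unfolding absolutely_continuous_def
proof
  interpret N: sigma_finite_measure N by fact
  fix B assume "B \<in> null_sets M"
  then have B [measurable]: "B \<in> sets N" and B0: "emeasure M B = 0"
    by (auto simp: sets_eq)
  obtain E :: "nat \<Rightarrow> 'a set" where E: "range E \<subseteq> sets N" "(\<Union>n. E n) = space N"
      "\<And>n. emeasure N (E n) \<noteq> \<infinity>"
    using N.sigma_finite by metis
  have [measurable]: "E n \<in> sets N" for n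
    using E(1) by auto
  have "B \<inter> E n \<in> null_sets N" for n
  proof -
    have M0: "emeasure M (B \<inter> E n) = 0"
      by (rule emeasure_eq_0[OF _ B0]) (use B sets_eq in auto)
    have "emeasure N (B \<inter> E n) \<le> ennreal \<epsilon>" if "\<epsilon> > 0" for \<epsilon>
    proof -
      have "E n \<in> sets N" "emeasure N (E n) < \<infinity>"
        using E(3)[of n] by (auto simp: less_top)
      then obtain \<eta> :: real where "\<eta> > 0" and
        \<eta>: "\<forall>A\<in>sets N. A \<subseteq> E n \<longrightarrow> emeasure M A < ennreal \<eta> \<longrightarrow> emeasure N A < ennreal \<epsilon>"
        using eac \<open>\<epsilon> > 0\<close> unfolding eps_absolutely_continuous_def by blast
      have "emeasure N (B \<inter> E n) < ennreal \<epsilon>"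
        using \<open>\<eta> > 0\<close> M0 by (intro \<eta>[rule_format]) auto
      then show ?thesis by simp
    qed
    then have "emeasure N (B \<inter> E n) \<le> 0"
      by - (rule ennreal_le_epsilon, simp)
    then show ?thesis by auto
  qed
  then have "(\<Union>n. B \<inter> E n) \<in> null_sets N"
    by (intro null_sets_UN) auto
  also have "(\<Union>n. B \<inter> E n) = B"
    using E(2) sets.sets_into_space[OF B] by auto
  finally show "B \<in> null_sets N" .
qed

text \<open>All counterexamples lie in the one set \<open>B0\<close> of finite
  \<open>N\<close>-measure. This makes \<open>N\<close> continuous from above along their tail
  unions, so their limes superior still has \<open>N\<close>-measure at least \<epsilon>.\<close>

lemma eps_absolutely_continuous_if_absolutely_continuous:
  assumes ac: "absolutely_continuous M N" and sets_eq: "sets N = sets M"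
  shows "eps_absolutely_continuous M N"
  unfolding eps_absolutely_continuous_def
proof (intro ballI impI allI, rule ccontr)
  fix B0 and \<epsilon> :: real
  assume B0: "B0 \<in> sets N" "emeasure N B0 < \<infinity>" and "\<epsilon> > 0"
    and contr: "\<not> (\<exists>\<eta>::real. \<eta> > 0 \<and> (\<forall>B\<in>sets N. B \<subseteq> B0 \<longrightarrow>
      emeasure M B < ennreal \<eta> \<longrightarrow> emeasure N B < ennreal \<epsilon>))"
  \<comment> \<open>The failing thresholds \<eta> are taken to be powers of 1/2, so that the
    \<open>M\<close>-measures of the chosen sets are dominated by a convergent geometric
    series.\<close>
  have "\<exists>B. B \<in> sets N \<and> B \<subseteq> B0 \<and> emeasure M B < ennreal ((1/2) ^ n) \<and>
      ennreal \<epsilon> \<le> emeasure N B" for n :: nat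
  proof -
    have "(1/2 :: real) ^ n > 0" by simp
    with contr obtain B where "B \<in> sets N" "B \<subseteq> B0" "emeasure M B < ennreal ((1/2) ^ n)"
        "\<not> emeasure N B < ennreal \<epsilon>"
      by blast
    then show ?thesis by (auto simp: not_less)
  qed
  then obtain B :: "nat \<Rightarrow> 'a set" where B: "\<And>n. B n \<in> sets N" "\<And>n. B n \<subseteq> B0"
      "\<And>n. emeasure M (B n) < ennreal ((1/2) ^ n)" "\<And>n. ennreal \<epsilon> \<le> emeasure N (B n)"
    by metis
  have "limsup B \<in> null_sets M"
  proof (rule borel_cantelli_limsup1)
    show "B n \<in> sets M" for n
      using B(1) sets_eq by simp
    show "emeasure M (B n) < \<infinity>" for n
      using less_trans[OF B(3)[of n] ennreal_less_top] by simp
    show "summable (\<lambda>n. measure M (B n))"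
    proof (rule summable_comparison_test'[OF summable_geometric, of "1/2" 0])
      show "norm (measure M (B n)) \<le> (1/2) ^ n" for n
        using less_imp_le[OF B(3)[of n]] by (simp add: measure_def enn2real_leI)
    qed simp
  qed
  then have "emeasure N (limsup B) = 0"
    using ac by (auto simp: absolutely_continuous_def)
  \<comment> \<open>The tail unions decrease to \<open>limsup B\<close>, and each has finite
    \<open>N\<close>-measure because it stays inside \<open>B0\<close>.\<close>
  define T where "T n = (\<Union>k\<in>{n..}. B k)" for n
  have T: "T n \<in> sets N" "T n \<subseteq> B0" for n
    using B(1,2) by (auto simp: T_def)
  have "emeasure N (T n) \<noteq> \<infinity>" for n
    using le_less_trans[OF emeasure_mono[OF T(2) B0(1)] B0(2)] by (simp add: less_top)
  moreover have "decseq T"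
    unfolding decseq_def T_def by (auto intro: order_trans)
  ultimately have "(INF n. emeasure N (T n)) = emeasure N (\<Inter>n. T n)"
    using T(1) by (intro INF_emeasure_decseq) auto
  also have "(\<Inter>n. T n) = limsup B"
    by (simp add: limsup_INF_SUP T_def)
  finally have "(INF n. emeasure N (T n)) = 0"
    using \<open>emeasure N (limsup B) = 0\<close> by simp
  \<comment> \<open>The tail \<open>T n\<close> contains \<open>B n\<close>, so no tail has
    \<open>N\<close>-measure below \<epsilon>.\<close>
  moreover have "ennreal \<epsilon> \<le> (INF n. emeasure N (T n))"
  proof (rule INF_greatest)
    fix n
    have "emeasure N (B n) \<le> emeasure N (T n)"
      by (rule emeasure_mono) (use T(1) in \<open>auto simp: T_def\<close>)
    with B(4)[of n] show "ennreal \<epsilon> \<le> emeasure N (T n)"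
      by (rule order_trans)
  qed
  ultimately show False
    using \<open>\<epsilon> > 0\<close> by simp
qed

lemma sigma_finite_measure_borel_extension:
  assumes "borel_extension X \<mu> M" "sigma_finite_valuation X \<mu>"
  shows "sigma_finite_measure M"
proof -
  obtain E :: "nat \<Rightarrow> 'a set" where E: "\<And>n. openin X (E n)" "\<And>n. \<mu> (E n) < \<infinity>"
      "(\<Union>n. E n) = topspace X"
    using assms(2) unfolding sigma_finite_valuation_def by blast
  show ?thesis
  proof (rule sigma_finite_measure.intro, intro exI conjI)
    show "countable (range E)" by simp
    show "range E \<subseteq> sets M"
      using E(1) assms(1) by (auto simp: borel_extension_def)
    show "\<Union> (range E) = space M"
      using E(3) assms(1) by (simp add: borel_extension_def)
    show "\<forall>a\<in>range E. emeasure M a \<noteq> \<infinity>"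
      using E(1,2) assms(1) by (auto simp: borel_extension_def less_top)
  qed
qed

text \<open>Two extensions agree on the open sets, an intersection-stable generator. The cover by
  sets of finite measure required for uniqueness can be taken inside this generator, as
  \<sigma>-finiteness of a valuation is witnessed by open sets.\<close>

lemma borel_extension_unique:
  assumes "sigma_finite_valuation X \<nu>" "borel_extension X \<nu> M" "borel_extension X \<nu> N"
  shows "M = N"
proof -
  obtain E :: "nat \<Rightarrow> 'a set" where E: "\<And>n. openin X (E n)" "\<And>n. \<nu> (E n) < \<infinity>"
      "(\<Union>n. E n) = topspace X"
    using assms(1) unfolding sigma_finite_valuation_def by blast
  show ?thesis
  proof (rule measure_eqI_generator_eq)
    show "Int_stable {U. openin X U}"
      by (auto simp: Int_stable_def)
    show "{U. openin X U} \<subseteq> Pow (topspace X)"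
      using openin_subset by auto
    show "range E \<subseteq> {U. openin X U}" "(\<Union>n. E n) = topspace X"
      using E by auto
    show "emeasure M (E n) \<noteq> \<infinity>" for n
      using E(1,2)[of n] assms(2) by (auto simp: borel_extension_def less_top)
  qed (use assms in \<open>auto simp: borel_extension_def\<close>)
qed

text \<open>If \<open>g\<close> represents \<nu> on open sets, then \<open>density M g\<close> is
  itself a Borel extension of \<nu> and must be \<open>N\<close> by uniqueness. This turns
  statements about valuations into statements about measures.\<close>

lemma is_density_valuation_iff_density:
  assumes M: "borel_extension X \<mu> M" and N: "borel_extension X \<nu> N"
    and sf: "sigma_finite_valuation X \<nu>" and g: "g \<in> borel_measurable M"
  shows "is_density_valuation X M g \<nu> \<longleftrightarrow> density M g = N"
proof -
  have eq: "emeasure (density M g) U = (\<integral>\<^sup>+x\<in>U. g x \<partial>M)" if "openin X U" for U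
    using that g M by (intro emeasure_density) (auto simp: borel_extension_def)
  show ?thesis
  proof
    assume "is_density_valuation X M g \<nu>"
    then have "borel_extension X \<nu> (density M g)"
      using M eq by (simp add: is_density_valuation_def borel_extension_def)
    then show "density M g = N"
      using borel_extension_unique[OF sf] N by blast
  next
    assume "density M g = N"
    then show "is_density_valuation X M g \<nu>"
      using N eq by (auto simp: is_density_valuation_def borel_extension_def)
  qed
qed

theorem theorem12:
  fixes X :: "'a topology" and \<mu> \<nu> :: "'a set \<Rightarrow> ennreal" and M N :: "'a measure"
  assumes "LCS_complete TYPE('b) X"
    and "continuous_valuation X \<mu>" and "sigma_finite_valuation X \<mu>"
    and "continuous_valuation X \<nu>" and "sigma_finite_valuation X \<nu>"
    and "borel_extension X \<mu> M" and "borel_extension X \<nu> N"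
  shows "(eps_absolutely_continuous M N \<longleftrightarrow>
            (\<exists>g \<in> borel_measurable M. is_density_valuation X M g \<nu>)) \<and>
         (\<forall>g \<in> borel_measurable M. \<forall>h \<in> borel_measurable M.
            is_density_valuation X M g \<nu> \<longrightarrow> is_density_valuation X M h \<nu> \<longrightarrow>
            (AE x in M. g x = h x))"
proof -
  note M = \<open>borel_extension X \<mu> M\<close> and N = \<open>borel_extension X \<nu> N\<close>
  interpret M: sigma_finite_measure M
    using M \<open>sigma_finite_valuation X \<mu>\<close> by (rule sigma_finite_measure_borel_extension)
  have sfN: "sigma_finite_measure N"
    using N \<open>sigma_finite_valuation X \<nu>\<close> by (rule sigma_finite_measure_borel_extension)
  have sets_eq: "sets N = sets M"
    using M N by (simp add: borel_extension_def)
  note density_iff = is_density_valuation_iff_density[OF M N \<open>sigma_finite_valuation X \<nu>\<close>]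
  have "eps_absolutely_continuous M N \<longleftrightarrow> absolutely_continuous M N"
    using absolutely_continuous_if_eps_absolutely_continuous[OF _ sets_eq sfN]
      eps_absolutely_continuous_if_absolutely_continuous[OF _ sets_eq] by blast
  \<comment> \<open>Radon--Nikodym for the \<sigma>-finite \<open>M\<close> gives the density;
    conversely, a measure with a density vanishes on the null sets of \<open>M\<close>.\<close>
  also have "\<dots> \<longleftrightarrow> (\<exists>g \<in> borel_measurable M. density M g = N)"
    using M.Radon_Nikodym[OF _ sets_eq] absolutely_continuousI_density by blast
  also have "\<dots> \<longleftrightarrow> (\<exists>g \<in> borel_measurable M. is_density_valuation X M g \<nu>)"
    using density_iff by blast
  \<comment> \<open>For uniqueness, two representing functions both have density measure
    \<open>N\<close>, and over a \<sigma>-finite measure equal density measures force equality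
    almost everywhere.\<close>
  finally show ?thesis
    by (auto simp: density_iff intro!: M.density_unique)
qed

end
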